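(* Let $\mathcal I=[0,1]$. For $u\in C^1(\mathcal I)$ let $$\mathcal N^0_1(u)=u'(0),\quad \mathcal N^0_2(u)=u'(1),\quad \mathcal N^0_3(u)=u(1)-u(0),\quad \mathcal N^0_4(u)=u(1)+u(0),$$ and for $v\in C^0(\mathcal I)$ let $$\mathcal N^1_1(v)=v(0),\quad \mathcal N^1_2(v)=v(1),\quad \mathcal N^1_3(v)=\int_{\mathcal I}v(x)\,dx.$$ Let $$\varphi^0_1(x)=x-2x^2+x^3,\quad \varphi^0_2(x)=-x^2+x^3,\quad \varphi^0_3(x)=-\tfrac12+3x^2-2x^3,\quad \varphi^0_4(x)=\tfrac12,$$ $$\varphi^1_1(x)=1-4x+3x^2,\quad \varphi^1_2(x)=-2x+3x^2,\quad \varphi^1_3(x)=6x-6x^2,$$ and define the interpolation operators $I_0\colon C^1\Lambda^0(\mathcal I)\to\mathbb P_3\Lambda^0(\mathcal I)$ and $I_1\colon C^0\Lambda^1(\mathcal I)\to\mathbb P_2\Lambda^1(\mathcal I)$ by $$I_0u=\sum_{i=1}^4\mathcal N^0_i(u)\,\varphi^0_i,\qquad I_1v=\sum_{j=1}^3\mathcal N^1_j(v)\,\varphi^1_j.$$ Then for every $u\in C^1\Lambda^0(\mathcal I)$ there holds $d^0I_0u=I_1d^0u$.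
   Context: On an interval, $0$-forms are functions and $1$-forms $v\,dx$ are identified with their coefficient function $v$, so that $C^1\Lambda^0(\mathcal I)=C^1(\mathcal I)$, $C^0\Lambda^1(\mathcal I)=C^0(\mathcal I)$, $\mathbb P_3\Lambda^0(\mathcal I)=\mathbb P_3(\mathcal I)$, $\mathbb P_2\Lambda^1(\mathcal I)=\mathbb P_2(\mathcal I)$ (polynomials of degree at most $3$, resp. $2$), and $d^0u=u'$. *)

theory Defs
  imports "HOL-Analysis.Analysis" "HOL-Computational_Algebra.Polynomial"
begin

text \<open>
  Functions on the interval are represented by total functions \<open>real \<Rightarrow> real\<close> whose values
  outside it are irrelevant; equality of functions on the interval is equality at its points.
  A 1-form is represented by its coefficient function.
\<close>

abbreviation Ival :: "real set" where
  "Ival \<equiv> {0..1}"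

text \<open>
  The exterior derivative on 0-forms. The derivative is taken within the interval,
  hence it is one-sided at the two end points.
\<close>

definition d0 :: "(real \<Rightarrow> real) \<Rightarrow> real \<Rightarrow> real" where
  "d0 u x = vector_derivative u (at x within Ival)"

text \<open>
  The library's \<open>C1_differentiable_on\<close> asks for two-sided derivatives, which would constrain
  the values outside the interval, so it does not describe \<open>C\<^sup>1[0,1]\<close>.
\<close>

definition C1_forms0 :: "(real \<Rightarrow> real) set" where
  "C1_forms0 = {u. u differentiable_on Ival \<and> continuous_on Ival (d0 u)}"

definition C0_forms1 :: "(real \<Rightarrow> real) set" where
  "C0_forms1 = {v. continuous_on Ival v}"

definition Poly_forms :: "nat \<Rightarrow> (real \<Rightarrow> real) set" where
  "Poly_forms n = {f. \<exists>p. degree p \<le> n \<and> (\<forall>x\<in>Ival. f x = poly p x)}"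

definition N0 :: "nat \<Rightarrow> (real \<Rightarrow> real) \<Rightarrow> real" where
  "N0 i u =
    (if i = 1 then d0 u 0
     else if i = 2 then d0 u 1
     else if i = 3 then u 1 - u 0
     else if i = 4 then u 1 + u 0
     else 0)"

definition N1 :: "nat \<Rightarrow> (real \<Rightarrow> real) \<Rightarrow> real" where
  "N1 j v =
    (if j = 1 then v 0
     else if j = 2 then v 1
     else if j = 3 then integral Ival v
     else 0)"

definition phi0 :: "nat \<Rightarrow> real \<Rightarrow> real" where
  "phi0 i x =
    (if i = 1 then x - 2 * x ^ 2 + x ^ 3
     else if i = 2 then - (x ^ 2) + x ^ 3
     else if i = 3 then - (1 / 2) + 3 * x ^ 2 - 2 * x ^ 3
     else if i = 4 then 1 / 2
     else 0)"

definition phi1 :: "nat \<Rightarrow> real \<Rightarrow> real" where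
  "phi1 j x =
    (if j = 1 then 1 - 4 * x + 3 * x ^ 2
     else if j = 2 then - (2 * x) + 3 * x ^ 2
     else if j = 3 then 6 * x - 6 * x ^ 2
     else 0)"

definition I0 :: "(real \<Rightarrow> real) \<Rightarrow> real \<Rightarrow> real" where
  "I0 u x = (\<Sum>i=1..4. N0 i u * phi0 i x)"

definition I1 :: "(real \<Rightarrow> real) \<Rightarrow> real \<Rightarrow> real" where
  "I1 v x = (\<Sum>j=1..3. N1 j v * phi1 j x)"

text \<open>The operators act between the intended spaces.\<close>

lemma d0_in_C0_forms1: "u \<in> C1_forms0 \<Longrightarrow> d0 u \<in> C0_forms1"
  by (simp add: C1_forms0_def C0_forms1_def)

lemma I0_in_Poly_forms: "I0 u \<in> Poly_forms 3"
proof -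
  define p :: "real poly" where
    "p = smult (N0 1 u) [:0, 1, -2, 1:] + smult (N0 2 u) [:0, 0, -1, 1:]
       + smult (N0 3 u) [:-1/2, 0, 3, -2:] + smult (N0 4 u) [:1/2:]"
  have "degree p \<le> 3"
    unfolding p_def by (intro degree_add_le order_trans[OF degree_smult_le]) auto
  moreover have "I0 u x = poly p x" for x
    by (simp add: I0_def p_def phi0_def numeral_eq_Suc algebra_simps)
  ultimately show ?thesis
    unfolding Poly_forms_def by blast
qed

lemma I1_in_Poly_forms: "I1 v \<in> Poly_forms 2"
proof -
  define p :: "real poly" where
    "p = smult (N1 1 v) [:1, -4, 3:] + smult (N1 2 v) [:0, -2, 3:]
       + smult (N1 3 v) [:0, 6, -6:]"
  have "degree p \<le> 2"
    unfolding p_def by (intro degree_add_le order_trans[OF degree_smult_le]) auto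
  moreover have "I1 v x = poly p x" for x
    by (simp add: I1_def p_def phi1_def numeral_eq_Suc algebra_simps)
  ultimately show ?thesis
    unfolding Poly_forms_def by blast
qed

end

theory Submission
  imports Defs
begin

text \<open>Differentiation matches the bases and the functionals: \<open>phi0 i\<close> has
  derivative \<open>phi1 i\<close> for i = 1, 2, 3, while \<open>phi0 4\<close> is constant
  (\<open>d0_I0\<close>). Moreover \<open>N0 i u = N1 i (d0 u)\<close> for these i: by definition at
  the end points, and by the fundamental theorem of calculus for i = 3 (\<open>integral_d0\<close>).
  So both sides are the same linear combination.\<close>

text \<open>Derivatives within a nondegenerate closed interval are unique, also at its end
  points.\<close>

lemma d0_eqI:
  assumes "(f has_real_derivative D) (at x within Ival)" "x \<in> Ival"
  shows "d0 f x = D"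
  unfolding d0_def
  using assms vector_derivative_within_closed_interval[of 0 1 x f D]
  by (simp add: has_real_derivative_iff_has_vector_derivative)

lemma sum_atLeast1_atMost4: "(\<Sum>i=1..4::nat. f i) = f 1 + f 2 + f 3 + (f 4 :: real)"
  by (simp add: numeral_eq_Suc)

lemma sum_atLeast1_atMost3: "(\<Sum>i=1..3::nat. f i) = f 1 + f 2 + (f 3 :: real)"
  by (simp add: numeral_eq_Suc)

lemma d0_I0:
  assumes "x \<in> Ival"
  shows "d0 (I0 u) x = N0 1 u * phi1 1 x + N0 2 u * phi1 2 x + N0 3 u * phi1 3 x"
proof (rule d0_eqI[OF _ assms])
  show "(I0 u has_real_derivative N0 1 u * phi1 1 x + N0 2 u * phi1 2 x + N0 3 u * phi1 3 x)
    (at x within Ival)"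
    unfolding I0_def sum_atLeast1_atMost4 phi0_def phi1_def
    by (auto intro!: derivative_eq_intros simp: algebra_simps)
qed

text \<open>\<open>integral\<close> is the gauge integral, which integrates every derivative, so
  differentiability suffices here.\<close>

lemma integral_d0:
  assumes "u differentiable_on Ival"
  shows "integral Ival (d0 u) = u 1 - u 0"
proof -
  have "(u has_vector_derivative d0 u x) (at x within Ival)" if "x \<in> Ival" for x
    using assms that unfolding d0_def
    by (simp add: differentiable_on_def vector_derivative_works)
  then have "(d0 u has_integral u 1 - u 0) Ival"
    by (intro fundamental_theorem_of_calculus) auto
  then show ?thesis
    by (rule integral_unique)
qed

theorem lemma4p2:
  fixes u :: "real \<Rightarrow> real"
  assumes "u \<in> C1_forms0"
  shows "\<forall>x\<in>Ival. d0 (I0 u) x = I1 (d0 u) x"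
proof
  fix x :: real
  assume "x \<in> Ival"
  have "integral Ival (d0 u) = u 1 - u 0"
    using assms by (intro integral_d0) (simp add: C1_forms0_def)
  then show "d0 (I0 u) x = I1 (d0 u) x"
    unfolding d0_I0[OF \<open>x \<in> Ival\<close>] I1_def sum_atLeast1_atMost3 by (simp add: N0_def N1_def)
qed

end
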